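(* Let $k\geq 1$. Let $\mathcal{A}=(a_1,a_2,\ldots,a_k)_{\bar r}$ be a finite sequence of integers, where $0<a_1<a_2<\cdots<a_k$ and $\bar r=(r_1,\ldots,r_k)$ with $r_i\geq 1$ for all $i$. Let $0\leq\alpha\leq \sum_{i=1}^k r_i-1$. Then there exists an integer $m\in[1,k]$ with $\sum_{i=1}^{m-1} r_i\leq \alpha<\sum_{i=1}^m r_i$, and \[|\Sigma_{\alpha}(\bar r,\mathcal{A})|\geq \sum_{i=1}^k i r_i-\sum_{i=1}^m i r_i+m\left(\sum_{i=1}^m r_i-\alpha\right)+1.\] Moreover, this lower bound is best possible, i.e., for given $k,\bar r,\alpha$ it is attained by some such sequence.
   Context: For distinct integers $a_1,\ldots,a_k$ and $\bar r=(r_1,\ldots,r_k)$ with $r_i\geq 1$, $(a_1,\ldots,a_k)_{\bar r}$ denotes the finite sequence consisting of $r_i$ copies of $a_i$ for each $i$. For such a sequence $\mathcal{A}$ and an integer $0\leq\alpha\leq\sum_i r_i$, $\Sigma_{\alpha}(\bar r,\mathcal{A})$ is the set of sums $s(\mathcal{B})$ of all terms of $\mathcal{B}$, over all subsequences $\mathcal{B}$ of $\mathcal{A}$ of length at least $\alpha$ (the empty subsequence has sum $0$). For integers $a\leq b$, $[a,b]=\{a,\ldots,b\}$; empty sums are $0$. *)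

theory Defs
  imports Complex_Main "HOL-Library.Sublist"
begin

definition rep_seq :: "nat \<Rightarrow> (nat \<Rightarrow> nat) \<Rightarrow> (nat \<Rightarrow> int) \<Rightarrow> int list" where
  "rep_seq k r a = concat (map (\<lambda>i. replicate (r i) (a i)) [1..<k+1])"

definition subseq_sums :: "nat \<Rightarrow> int list \<Rightarrow> int set" where
  "subseq_sums \<alpha> xs = {sum_list ys | ys. subseq ys xs \<and> \<alpha> \<le> length ys}"

(* Hence card (subseq_sums \<alpha> xs) is a genuine cardinality. *)
lemma finite_subseq_sums: "finite (subseq_sums \<alpha> xs)"
proof -
  have "subseq_sums \<alpha> xs \<subseteq> sum_list ` set (subseqs xs)"
    by (auto simp: subseq_sums_def)
  then show ?thesis
    by (rule finite_subset) simp
qed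

end

theory Submission
  imports Defs
begin

text \<open>
  A subsequence is described by its vector of multiplicities b with b i \<le> r i; its rank is the
  sum of the i * b i. If b \<noteq> r, take the least i with b i < r i and either adjoin a copy of the
  first term (i = 1) or exchange a copy of term i - 1 for a copy of term i. This raises the rank
  by exactly 1, strictly raises the sum and does not shorten the subsequence. Starting from the
  \<alpha> smallest terms one thus obtains as many distinct sums as the bound requires. For a i = i
  the sum is the rank, and it lies between the rank of the \<alpha> smallest terms and that of the
  whole sequence, so that the bound is attained.
\<close>

section \<open>Subsequences as vectors of multiplicities\<close>

lemma rep_seq_0 [simp]: "rep_seq 0 r a = []"
  by (simp add: rep_seq_def)

lemma rep_seq_Suc [simp]:
  "rep_seq (Suc k) r a = rep_seq k r a @ replicate (r (Suc k)) (a (Suc k))"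
  by (simp add: rep_seq_def)

lemma rep_seq_cong: "(\<And>i. i \<in> {1..k} \<Longrightarrow> b i = c i) \<Longrightarrow> rep_seq k b a = rep_seq k c a"
  by (induction k) auto

lemma length_rep_seq: "length (rep_seq k b a) = (\<Sum>i=1..k. b i)"
  by (induction k) auto

lemma sum_list_rep_seq: "sum_list (rep_seq k b a) = (\<Sum>i=1..k. int (b i) * a i)"
  by (induction k) (auto simp: sum_list_replicate)

lemma subseq_replicate_imp:
  assumes "subseq ys (replicate n x)"
  shows "\<exists>j\<le>n. ys = replicate j x"
proof (intro exI conjI)
  show "length ys \<le> n"
    using list_emb_length[OF assms] by simp
  have "y = x" if "y \<in> set ys" for y
    using list_emb_set[OF assms that] by auto
  then show "ys = replicate (length ys) x"
    by (intro replicate_eqI) auto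
qed

text \<open>Forward, a subsequence of a concatenation splits at the seam, and its part inside a
  constant block is a constant block that is no longer; induction on \<open>k\<close> collects these
  lengths in \<open>b\<close>.\<close>

lemma subseq_rep_seq_iff:
  "subseq ys (rep_seq k r a) \<longleftrightarrow> (\<exists>b. (\<forall>i\<in>{1..k}. b i \<le> r i) \<and> ys = rep_seq k b a)"
proof
  show "subseq ys (rep_seq k r a) \<Longrightarrow> \<exists>b. (\<forall>i\<in>{1..k}. b i \<le> r i) \<and> ys = rep_seq k b a"
  proof (induction k arbitrary: ys)
    case (Suc k)
    then have "subseq ys (rep_seq k r a @ replicate (r (Suc k)) (a (Suc k)))"
      by simp
    then obtain us vs where ys: "ys = us @ vs" and us: "subseq us (rep_seq k r a)"
      and vs: "subseq vs (replicate (r (Suc k)) (a (Suc k)))"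
      by (auto elim: subseq_appendE)
    obtain b where b: "\<forall>i\<in>{1..k}. b i \<le> r i" "us = rep_seq k b a"
      using Suc.IH[OF us] by blast
    obtain j where j: "j \<le> r (Suc k)" "vs = replicate j (a (Suc k))"
      using subseq_replicate_imp[OF vs] by blast
    have "rep_seq k (b(Suc k := j)) a = rep_seq k b a"
      by (rule rep_seq_cong) auto
    then have "ys = rep_seq (Suc k) (b(Suc k := j)) a"
      using ys b j by (simp only: rep_seq_Suc fun_upd_same)
    moreover have "\<forall>i\<in>{1..Suc k}. (b(Suc k := j)) i \<le> r i"
      using b j by (auto simp: le_Suc_eq)
    ultimately show ?case
      by blast
  qed simp
next
  have "subseq (rep_seq k b a) (rep_seq k r a)" if "\<forall>i\<in>{1..k}. b i \<le> r i" for b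
    using that
  proof (induction k)
    case (Suc k)
    have "subseq (replicate (b (Suc k)) (a (Suc k))) (replicate (r (Suc k)) (a (Suc k)))"
    proof -
      have "b (Suc k) \<le> r (Suc k)" using Suc.prems by simp
      then obtain d where "r (Suc k) = d + b (Suc k)" by (metis le_add_diff_inverse2)
      then show ?thesis by (simp add: replicate_add list_emb_append2)
    qed
    then show ?case
      using Suc by (simp add: list_emb_append_mono)
  qed simp
  then show "\<exists>b. (\<forall>i\<in>{1..k}. b i \<le> r i) \<and> ys = rep_seq k b a \<Longrightarrow> subseq ys (rep_seq k r a)"
    by blast
qed

lemma subseq_sums_rep_seq:
  "subseq_sums \<alpha> (rep_seq k r a) =
    {\<Sum>i=1..k. int (b i) * a i | b. (\<forall>i\<in>{1..k}. b i \<le> r i) \<and> \<alpha> \<le> (\<Sum>i=1..k. b i)}"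
  unfolding subseq_sums_def subseq_rep_seq_iff length_rep_seq[of k _ a, symmetric]
    sum_list_rep_seq[symmetric]
  by blast

section \<open>Ranks of multiplicity vectors\<close>

lemma sum_fun_upd_diff:
  fixes f :: "nat \<Rightarrow> nat \<Rightarrow> 'b::ab_group_add"
  assumes "finite A" "j \<in> A"
  shows "(\<Sum>i\<in>A. f i ((b(j := n)) i)) = (\<Sum>i\<in>A. f i (b i)) + (f j n - f j (b j))"
proof -
  have "(\<Sum>i\<in>A - {j}. f i ((b(j := n)) i)) = (\<Sum>i\<in>A - {j}. f i (b i))"
    by (rule sum.cong) auto
  then show ?thesis
    using assms by (simp add: sum.remove[of A j])
qed

lemma rank_step:
  fixes a :: "nat \<Rightarrow> int"
  assumes r: "\<forall>i\<in>{1..k}. r i \<ge> 1"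
    and a: "0 < a 1" "strict_mono_on {1..k} a"
    and b: "\<forall>i\<in>{1..k}. b i \<le> r i" "\<exists>i\<in>{1..k}. b i < r i"
  obtains c where "\<forall>i\<in>{1..k}. c i \<le> r i" "(\<Sum>i=1..k. b i) \<le> (\<Sum>i=1..k. c i)"
    "(\<Sum>i=1..k. int (c i) * int i) = (\<Sum>i=1..k. int (b i) * int i) + 1"
    "(\<Sum>i=1..k. int (b i) * a i) < (\<Sum>i=1..k. int (c i) * a i)"
proof -
  define j where "j = (LEAST i. i \<in> {1..k} \<and> b i < r i)"
  have j: "j \<in> {1..k}" "b j < r j"
    using LeastI_ex[of "\<lambda>i. i \<in> {1..k} \<and> b i < r i"] b(2) unfolding j_def by blast+
  define b' where "b' = b(j := Suc (b j))"
  \<comment> \<open>The free weight \<open>w\<close> serves three purposes: constant 1 gives the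
    length, \<open>int\<close> the rank and \<open>a\<close> the sum of the subsequence.\<close>
  have sum_b': "(\<Sum>i=1..k. int (b' i) * w i) = (\<Sum>i=1..k. int (b i) * w i) + w j" for w
    using sum_fun_upd_diff[of "{1..k}" j "\<lambda>i x. int x * w i" b "Suc (b j)"] j(1)
    by (simp add: b'_def algebra_simps)
  show thesis
  proof (cases "j = 1")
    case True
    have "(\<Sum>i=1..k. int (b i)) \<le> (\<Sum>i=1..k. int (b' i))"
      using sum_b'[of "\<lambda>_. 1"] by simp
    then have "(\<Sum>i=1..k. b i) \<le> (\<Sum>i=1..k. b' i)"
      by (simp flip: of_nat_sum)
    then show thesis
      using that[of b'] sum_b'[of int] sum_b'[of a] a(1) b(1) j True
      by (auto simp: b'_def)
  next
    case False
    define l where "l = j - 1"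
    have l: "l \<in> {1..k}" "l < j" "j = Suc l"
      using False j(1) by (auto simp: l_def)
    \<comment> \<open>Leastness of \<open>j\<close> makes block \<open>l\<close> full; as
      \<open>r l\<close> is positive, it has a copy to give up, and the subtraction in
      \<open>b l - 1\<close> is exact.\<close>
    then have "\<not> b l < r l"
      using not_less_Least[of l "\<lambda>i. i \<in> {1..k} \<and> b i < r i"] unfolding j_def by blast
    then have bl: "b l \<ge> 1"
      using r l(1) by fastforce
    define c where "c = b'(l := b l - 1)"
    have b'l: "b' l = b l"
      using l by (simp add: b'_def)
    have sum_c: "(\<Sum>i=1..k. int (c i) * w i) = (\<Sum>i=1..k. int (b i) * w i) + w j - w l" for w
      using sum_fun_upd_diff[of "{1..k}" l "\<lambda>i x. int x * w i" b' "b l - 1"] l(1) bl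
      sum_b'[of w]
      by (simp add: c_def b'l algebra_simps)
    have "(\<Sum>i=1..k. int (b i)) \<le> (\<Sum>i=1..k. int (c i))"
      using sum_c[of "\<lambda>_. 1"] by simp
    then have "(\<Sum>i=1..k. b i) \<le> (\<Sum>i=1..k. c i)"
      by (simp flip: of_nat_sum)
    moreover have "a l < a j"
      using a(2) l j(1) by (auto simp: strict_mono_on_def)
    moreover have "\<forall>i\<in>{1..k}. c i \<le> r i"
      using b(1) j by (auto simp: c_def b'_def le_diff_conv trans_le_add1)
    ultimately show thesis
      using that[of c] sum_c[of int] sum_c[of a] l(3) by simp
  qed
qed

text \<open>Here \<open>n\<close> is the rank still missing to the full sequence. Counting only sums
  that are at least the sum of \<open>b\<close> makes the induction work: after a step from
  \<open>b\<close> to \<open>c\<close>, the sum of \<open>b\<close> lies strictly below every sum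
  already counted and is one more.\<close>

lemma card_sums_ge_rank_diff:
  fixes a :: "nat \<Rightarrow> int"
  assumes r: "\<forall>i\<in>{1..k}. r i \<ge> 1"
    and a: "0 < a 1" "strict_mono_on {1..k} a"
    and "\<forall>i\<in>{1..k}. b i \<le> r i" "\<alpha> \<le> (\<Sum>i=1..k. b i)"
    and "(\<Sum>i=1..k. int (r i) * int i) = (\<Sum>i=1..k. int (b i) * int i) + int n"
  shows "Suc n \<le> card {s \<in> subseq_sums \<alpha> (rep_seq k r a). (\<Sum>i=1..k. int (b i) * a i) \<le> s}"
  using assms(4-)
proof (induction n arbitrary: b)
  let ?S = "subseq_sums \<alpha> (rep_seq k r a)"
  let ?v = "\<lambda>b. \<Sum>i=1..k. int (b i) * a i"
  have mem: "?v b \<in> ?S" if "\<forall>i\<in>{1..k}. b i \<le> r i" "\<alpha> \<le> (\<Sum>i=1..k. b i)" for b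
    using that unfolding subseq_sums_rep_seq by blast
  have fin: "finite {s \<in> ?S. x \<le> s}" for x
    using finite_subseq_sums by simp
  {
    case 0
    then have "{s \<in> ?S. ?v b \<le> s} \<noteq> {}"
      using mem by blast
    then show ?case
      using fin by (simp add: Suc_le_eq card_gt_0_iff)
  next
    case (Suc n)
    \<comment> \<open>The missing rank is positive, so some block is not full.\<close>
    have "\<exists>i\<in>{1..k}. b i < r i"
    proof (rule ccontr)
      assume "\<not> ?thesis"
      then have "(\<Sum>i=1..k. int (r i) * int i) = (\<Sum>i=1..k. int (b i) * int i)"
        using Suc.prems(1) by (intro sum.cong) (auto simp: not_less intro: antisym)
      then show False
        using Suc.prems(3) by simp
    qed
    then obtain c where c: "\<forall>i\<in>{1..k}. c i \<le> r i" "(\<Sum>i=1..k. b i) \<le> (\<Sum>i=1..k. c i)"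
      "(\<Sum>i=1..k. int (c i) * int i) = (\<Sum>i=1..k. int (b i) * int i) + 1" "?v b < ?v c"
      using rank_step[OF r a Suc.prems(1)] by blast
    have "Suc n \<le> card {s \<in> ?S. ?v c \<le> s}"
      using Suc.prems c by (intro Suc.IH) auto
    also have "\<dots> < card {s \<in> ?S. ?v b \<le> s}"
    proof (rule psubset_card_mono[OF fin])
      have "?v b \<in> {s \<in> ?S. ?v b \<le> s} - {s \<in> ?S. ?v c \<le> s}"
        using mem Suc.prems c(4) by auto
      moreover have "{s \<in> ?S. ?v c \<le> s} \<subseteq> {s \<in> ?S. ?v b \<le> s}"
        using c(4) by auto
      ultimately show "{s \<in> ?S. ?v c \<le> s} \<subset> {s \<in> ?S. ?v b \<le> s}"
        by blast
    qed
    finally show ?case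
      by simp
  }
qed

text \<open>Weighting block \<open>i\<close> by \<open>i - m\<close> turns the length bound into a
  rank bound: weights up to \<open>m\<close> are at most 0, so filling these blocks can only lower
  the sum, and weights beyond \<open>m\<close> are positive, so dropping those blocks can only lower
  it.\<close>

lemma rank_ge_of_length:
  assumes b: "\<forall>i\<in>{1..k}. b i \<le> r i" and "\<alpha> \<le> (\<Sum>i=1..k. b i)" and "m \<le> k"
  shows "(\<Sum>i=1..m. int i * int (r i)) - int m * ((\<Sum>i=1..m. int (r i)) - int \<alpha>)
    \<le> (\<Sum>i=1..k. int (b i) * int i)"
proof -
  have "(\<Sum>i=1..m. (int i - int m) * int (r i)) \<le> (\<Sum>i=1..m. (int i - int m) * int (b i))"
    using b \<open>m \<le> k\<close> by (intro sum_mono mult_left_mono_neg) auto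
  also have "\<dots> \<le> (\<Sum>i=1..k. (int i - int m) * int (b i))"
    using \<open>m \<le> k\<close> by (intro sum_mono2) auto
  also have "\<dots> = (\<Sum>i=1..k. int (b i) * int i) - int m * int (\<Sum>i=1..k. b i)"
    by (simp add: sum_subtractf sum_distrib_left algebra_simps)
  also have "\<dots> \<le> (\<Sum>i=1..k. int (b i) * int i) - int m * int \<alpha>"
    using assms(2) by (intro diff_left_mono mult_left_mono) (simp_all only: of_nat_le_iff of_nat_0_le_iff)
  finally show ?thesis
    by (simp add: sum_subtractf sum_distrib_left algebra_simps)
qed

section \<open>The bound and its sharpness\<close>

theorem theorem3p1:
  fixes k \<alpha> :: nat and r :: "nat \<Rightarrow> nat"
  assumes "k \<ge> 1"
    and "\<forall>i\<in>{1..k}. r i \<ge> 1"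
    and "int \<alpha> \<le> (\<Sum>i=1..k. int (r i)) - 1"
  shows "\<exists>m\<in>{1..k}. (\<Sum>i=1..<m. r i) \<le> \<alpha> \<and> \<alpha> < (\<Sum>i=1..m. r i) \<and>
    (let L = (\<Sum>i=1..k. int i * int (r i)) - (\<Sum>i=1..m. int i * int (r i))
               + int m * ((\<Sum>i=1..m. int (r i)) - int \<alpha>) + 1
     in (\<forall>a :: nat \<Rightarrow> int. 0 < a 1 \<and> strict_mono_on {1..k} a \<longrightarrow>
           int (card (subseq_sums \<alpha> (rep_seq k r a))) \<ge> L) \<and>
        (\<exists>a :: nat \<Rightarrow> int. 0 < a 1 \<and> strict_mono_on {1..k} a \<and>
           int (card (subseq_sums \<alpha> (rep_seq k r a))) = L))"
proof -
  have \<alpha>k: "\<alpha> < (\<Sum>i=1..k. r i)"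
    using assms(3) by (simp flip: of_nat_sum)
  \<comment> \<open>Leastness yields the other inequality, that the blocks before \<open>m\<close>
    hold at most \<alpha> terms.\<close>
  define m where "m = (LEAST m. \<alpha> < (\<Sum>i=1..m. r i))"
  have m_less: "\<alpha> < (\<Sum>i=1..m. r i)"
    unfolding m_def using \<alpha>k by (rule LeastI)
  have "m \<le> k"
    unfolding m_def using \<alpha>k by (rule Least_le)
  moreover have "m \<noteq> 0"
    using m_less by (cases "m = 0") auto
  ultimately have m: "m \<in> {1..k}"
    by simp
  then obtain p where p: "m = Suc p"
    by (cases m) auto
  have "\<not> \<alpha> < (\<Sum>i=1..p. r i)"
    using not_less_Least[of p "\<lambda>m. \<alpha> < (\<Sum>i=1..m. r i)"] p unfolding m_def by simp
  then have p_le: "(\<Sum>i=1..p. r i) \<le> \<alpha>"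
    by simp
  have less_m: "{1..<m} = {1..p}"
    using p by auto
  define L where "L = (\<Sum>i=1..k. int i * int (r i)) - (\<Sum>i=1..m. int i * int (r i))
               + int m * ((\<Sum>i=1..m. int (r i)) - int \<alpha>) + 1"
  \<comment> \<open>The \<alpha> smallest terms: all blocks before \<open>m\<close>, completed by
    copies of term \<open>m\<close>.\<close>
  define b where "b = (\<lambda>i. if i \<le> p then r i else if i = m then \<alpha> - (\<Sum>i=1..p. r i) else 0)"
  have sum_b: "(\<Sum>i=1..k. int (b i) * w i) =
      (\<Sum>i=1..p. int (r i) * w i) + (int \<alpha> - (\<Sum>i=1..p. int (r i))) * w m" for w
  proof -
    have "(\<Sum>i=1..k. int (b i) * w i) = (\<Sum>i=1..m. int (b i) * w i)"
      using m p by (intro sum.mono_neutral_right) (auto simp: b_def)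
    also have "\<dots> = (\<Sum>i=1..p. int (b i) * w i) + int (b m) * w m"
      using p by simp
    also have "(\<Sum>i=1..p. int (b i) * w i) = (\<Sum>i=1..p. int (r i) * w i)"
      by (intro sum.cong) (auto simp: b_def)
    also have "int (b m) = int \<alpha> - (\<Sum>i=1..p. int (r i))"
      using p p_le by (simp add: b_def of_nat_diff)
    finally show ?thesis .
  qed
  have b_le: "\<forall>i\<in>{1..k}. b i \<le> r i"
    using m_less p by (auto simp: b_def)
  have "int (\<Sum>i=1..k. b i) = int \<alpha>"
    using sum_b[of "\<lambda>_. 1"] by simp
  then have len_b: "(\<Sum>i=1..k. b i) = \<alpha>"
    by (simp only: of_nat_eq_iff)
  \<comment> \<open>\<open>L - 1\<close> is exactly the rank that \<open>b\<close> lacks, hence a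
    natural number \<open>n\<close> to which the counting lemma applies.\<close>
  have rank_b: "(\<Sum>i=1..k. int (r i) * int i) = (\<Sum>i=1..k. int (b i) * int i) + (L - 1)"
    unfolding sum_b L_def using p by (simp add: algebra_simps)
  have "(\<Sum>i=1..k. int (b i) * int i) \<le> (\<Sum>i=1..k. int (r i) * int i)"
    using b_le by (intro sum_mono mult_right_mono) auto
  then obtain n where n: "L - 1 = int n"
    using rank_b by (metis le_add_same_cancel1 nonneg_int_cases)
  have lower: "L \<le> int (card (subseq_sums \<alpha> (rep_seq k r a)))"
    if a: "0 < a 1" "strict_mono_on {1..k} a" for a :: "nat \<Rightarrow> int"
  proof -
    have "Suc n \<le> card {s \<in> subseq_sums \<alpha> (rep_seq k r a). (\<Sum>i=1..k. int (b i) * a i) \<le> s}"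
      using rank_b n len_b by (intro card_sums_ge_rank_diff assms a b_le) auto
    also have "\<dots> \<le> card (subseq_sums \<alpha> (rep_seq k r a))"
      by (intro card_mono finite_subseq_sums) auto
    finally show ?thesis
      using n by simp
  qed
  have int_mono: "strict_mono_on {1..k} int"
    by (auto simp: strict_mono_on_def)
  let ?T = "\<Sum>i=1..k. int (r i) * int i"
  \<comment> \<open>This interval contains exactly \<open>L\<close> integers. Its lower end is the
    rank of the \<alpha> smallest terms.\<close>
  have "subseq_sums \<alpha> (rep_seq k r int) \<subseteq> {?T - (L - 1)..?T}"
  proof
    fix s assume "s \<in> subseq_sums \<alpha> (rep_seq k r int)"
    then obtain c where c: "\<forall>i\<in>{1..k}. c i \<le> r i" "\<alpha> \<le> (\<Sum>i=1..k. c i)"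
      and s: "s = (\<Sum>i=1..k. int (c i) * int i)"
      unfolding subseq_sums_rep_seq by blast
    have "s \<le> ?T"
      unfolding s using c(1) by (intro sum_mono mult_right_mono) auto
    moreover have "?T - (L - 1) \<le> s"
      using rank_ge_of_length[OF c \<open>m \<le> k\<close>] unfolding s L_def by (simp add: mult.commute)
    ultimately show "s \<in> {?T - (L - 1)..?T}"
      by simp
  qed
  then have "card (subseq_sums \<alpha> (rep_seq k r int)) \<le> card {?T - (L - 1)..?T}"
    by (intro card_mono) auto
  then have "int (card (subseq_sums \<alpha> (rep_seq k r int))) \<le> L"
    using n by simp
  moreover have "L \<le> int (card (subseq_sums \<alpha> (rep_seq k r int)))"
    using int_mono by (intro lower) auto
  ultimately have eq: "int (card (subseq_sums \<alpha> (rep_seq k r int))) = L"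
    by simp
  show ?thesis
    unfolding Let_def
  proof (rule bexI[OF _ m], fold L_def, intro conjI allI impI)
    show "(\<Sum>i=1..<m. r i) \<le> \<alpha>"
      unfolding less_m by (rule p_le)
    show "\<exists>a :: nat \<Rightarrow> int. 0 < a 1 \<and> strict_mono_on {1..k} a \<and>
        int (card (subseq_sums \<alpha> (rep_seq k r a))) = L"
      using int_mono eq by (intro exI[of _ int]) simp
  qed (use m_less lower in auto)
qed

end
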